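(* Let $D=\{0\}\cup[1,\infty)$ and let $\mathbb{N}$ be the set of non-negative integers. Suppose $\mathcal{F}$ is a natural exponential family with basis $\beta$ and with power variance function $V(u)=au^r$ on the mean domain $U=(0,\infty)$, where $a>0$ and $r\in D\setminus\mathbb{N}$. Let $\rho$ be the measure induced by $\mathcal{F}$ and let $\alpha=\beta\ast\rho$. Then $\alpha\ll\beta$, and $\varphi=\frac{d\alpha}{d\beta}$ is a reduction function for $\mathcal{F}$, i.e. $\mathbb{E}[\varphi(\xi_\theta)]=\mathbb{V}[\xi_\theta]$ for all $\theta\in\Theta$, where $\xi_\theta$ has distribution $F_\theta$.
   Context: Natural exponential family (NEF): let $\beta$ be a positive Radon measure on $\mathbb{R}$ not concentrated on one point, let $L(\theta)=\int e^{x\theta}\beta(dx)$ be its Laplace transform, and let $\Theta$ be the maximal open set of $\theta\in\mathbb{R}$ with $L(\theta)<\infty$, assumed non-empty. The NEF with basis $\beta$ is $\mathcal{F}=\{F_\theta:\theta\in\Theta\}$, $F_\theta(dx)=\exp[\theta x-\log L(\theta)]\,\beta(dx)$. (Without loss of generality one may take $0\in\Theta$ and $\beta(\mathbb{R})=1$.) Let $\kappa(\theta)=\log L(\theta)$. The mean function is $\mu(\theta)=\int xF_\theta(dx)=\kappa'(\theta)$, the mean domain is $U=\mu(\Theta)$, and $\theta(\mu)$ denotes the inverse of $\mu:\Theta\to U$. The variance function is $V(u)=\int(x-u)^2F_{\theta(u)}(dx)$ for $u\in U$; as a function of $\theta$ the variance is $\kappa''(\theta)$. A NEF with power variance function (NEF-PVF)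 is a NEF with $V(u)=au^r$ on $U$ for some $a>0$ and $r\in\mathbb{R}$; necessarily $r\in D$, and $U=(0,\infty)$ when $r\in D\setminus\{0\}$. It is known (Bar-Lev and Enis) that every NEF-PVF is infinitely divisible, i.e. its members are infinitely divisible probability measures. For an infinitely divisible NEF, the induced measure $\rho$ is the positive measure on $\mathbb{R}$ with $\kappa''(\theta)=\int e^{\theta x}\rho(dx)$ for all $\theta\in\Theta$; it equals $\rho(dx)=\sigma^2\delta_0(dx)+x^2\nu(dx)$, where $\sigma^2\ge0$ and $\nu$ are the Gaussian variance and Lévy measure in the Lévy–Khintchine representation $\kappa(\theta)=\epsilon\theta+\frac12\sigma^2\theta^2+\int_{\mathbb{R}\setminus\{0\}}(e^{\theta x}-1-\theta\tau(x))\nu(dx)$, with $\tau$ a centering function, i.e. $x^{-2}(\tau(x)-x)$ is bounded as $x\to0$. $\ast$ denotes convolution of measures, $\alpha\ll\beta$ means $\alpha$ is absolutely continuous with respect to $\beta$, $\frac{d\alpha}{d\beta}$ is the Radon–Nikodym derivative, and $\mathbb{E}$, $\mathbb{V}$ denote mean and variance. A reduction function for $\mathcal{F}$ is a function $\varphi$, independent of $\theta$, with $\mathbb{E}[\varphi(\xi_\theta)]=\mathbb{V}[\xi_\theta]$ for all $\theta\in\Theta$; equivalently, $\int\varphi(x)e^{x\theta}\beta(dx)=L(\theta)\kappa''(\theta)$ for all $\theta\in\Theta$. *)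

theory Defs
  imports "HOL-Probability.Probability"
begin

definition laplace :: "real measure \<Rightarrow> real \<Rightarrow> ennreal" where
  "laplace \<beta> \<theta> = (\<integral>\<^sup>+ x. ennreal (exp (x * \<theta>)) \<partial>\<beta>)"

text \<open>The set where the Laplace transform is finite is an interval; \<open>nef_domain\<close> is the
  largest open set contained in it.\<close>

definition nef_domain :: "real measure \<Rightarrow> real set" where
  "nef_domain \<beta> = interior {\<theta>. laplace \<beta> \<theta> < \<infinity>}"

definition radon_measure_on_reals :: "real measure \<Rightarrow> bool" where
  "radon_measure_on_reals \<beta> \<longleftrightarrow>
     sets \<beta> = sets borel \<and> (\<forall>K. compact K \<longrightarrow> emeasure \<beta> K < \<infinity>)"

text \<open>Not being concentrated on one point also excludes the zero measure.\<close>

definition nef_basis :: "real measure \<Rightarrow> bool" where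
  "nef_basis \<beta> \<longleftrightarrow>
     radon_measure_on_reals \<beta> \<and>
     \<not> (\<exists>c. AE x in \<beta>. x = c) \<and>
     nef_domain \<beta> \<noteq> {}"

definition cumulant :: "real measure \<Rightarrow> real \<Rightarrow> real" where
  "cumulant \<beta> \<theta> = ln (enn2real (laplace \<beta> \<theta>))"

definition nef_member :: "real measure \<Rightarrow> real \<Rightarrow> real measure" where
  "nef_member \<beta> \<theta> = density \<beta> (\<lambda>x. ennreal (exp (\<theta> * x - cumulant \<beta> \<theta>)))"

definition mean_function :: "real measure \<Rightarrow> real \<Rightarrow> real" where
  "mean_function \<beta> \<theta> = (\<integral>x. x \<partial>nef_member \<beta> \<theta>)"

definition mean_domain :: "real measure \<Rightarrow> real set" where
  "mean_domain \<beta> = mean_function \<beta> ` nef_domain \<beta>"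

definition variance_function :: "real measure \<Rightarrow> real \<Rightarrow> real" where
  "variance_function \<beta> u =
     (\<integral>x. (x - u)\<^sup>2 \<partial>nef_member \<beta> (inv_into (nef_domain \<beta>) (mean_function \<beta>) u))"

text \<open>A Borel measure on the reals is determined by its Laplace transform on a non-empty open
  set on which that transform is finite, so at most one measure satisfies this description.
  Note that replacing the basis of a family by an exponentially tilted one tilts the
  induced measure as well; it is therefore a function of the basis.\<close>

definition induced_measure :: "real measure \<Rightarrow> real measure" where
  "induced_measure \<beta> =
     (THE \<rho>. sets \<rho> = sets borel \<and>
        (\<forall>\<theta>\<in>nef_domain \<beta>. laplace \<rho> \<theta> = ennreal (deriv (deriv (cumulant \<beta>)) \<theta>)))"

text \<open>Integrability is demanded because the Bochner integral of a non-integrable function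
  is 0.\<close>

definition reduction_function :: "real measure \<Rightarrow> (real \<Rightarrow> real) \<Rightarrow> bool" where
  "reduction_function \<beta> \<phi> \<longleftrightarrow>
     (\<forall>\<theta>\<in>nef_domain \<beta>.
        integrable (nef_member \<beta> \<theta>) \<phi> \<and>
        prob_space.expectation (nef_member \<beta> \<theta>) \<phi> =
          prob_space.variance (nef_member \<beta> \<theta>) (\<lambda>x. x))"

end

theory Submission
  imports Defs "HOL-Complex_Analysis.Conformal_Mappings"
begin

text \<open>
  Since \<open>\<mu> = \<kappa>'\<close> satisfies \<open>\<mu>' = a \<mu> powr r\<close> and is onto \<open>(0, \<infinity>)\<close>, one has \<open>\<Theta> = (- \<infinity>, c)\<close> and
  \<open>\<mu>(\<theta>) = K (c - \<theta>) powr (- p)\<close> with \<open>p = 1 / (r - 1)\<close>. So \<open>\<kappa>'\<close> and \<open>\<kappa>''\<close> are the Laplace transforms of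
  measures \<open>m\<close> and \<open>\<rho>\<close> whose Lebesgue densities are of gamma type, positive exactly on \<open>(0, \<infinity>)\<close>.
  By uniqueness of Laplace transforms, \<open>L' = L \<kappa>'\<close> says that \<open>x \<beta>(dx) = \<beta> * m\<close>. A convolution of
  \<open>\<beta>\<close> with a measure of density \<open>g\<close> has density \<open>z \<mapsto> \<integral> g(z - x) \<beta>(dx)\<close>, whose zero set depends only
  on that of \<open>g\<close>; hence \<open>\<alpha> = \<beta> * \<rho>\<close> has the same null sets as \<open>x \<beta>(dx)\<close>, and is absolutely continuous
  with respect to \<open>\<beta>\<close>. This treats compound Poisson bases (\<open>r < 2\<close>) and tilted stable bases (\<open>r > 2\<close>)
  alike, and no explicit formula for \<open>\<beta>\<close> is needed.
\<close>

section \<open>Laplace transforms of measures on the line\<close>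

lemma abs_power_le_exp:
  fixes d :: real
  assumes "d > 0"
  shows "\<exists>C>0. \<forall>x::real. \<bar>x\<bar> ^ k \<le> C * exp (d * \<bar>x\<bar>)"
proof (cases "k = 0")
  case True
  then show ?thesis using assms by (intro exI[of _ 1]) auto
next
  case False
  \<comment> \<open>The constant comes from \<open>(1 + t / k) ^ k \<le> exp t\<close> at t = d |x|,
    after dropping the 1. The case k = 0 is treated apart because of the division by k.\<close>
  have "\<bar>x\<bar> ^ k \<le> (k / d) ^ k * exp (d * \<bar>x\<bar>)" for x :: real
  proof -
    have "(d * \<bar>x\<bar> / k) ^ k \<le> (1 + d * \<bar>x\<bar> / k) ^ k"
      using assms by (intro power_mono) auto
    also have "\<dots> \<le> exp (d * \<bar>x\<bar>)"
      using False assms by (intro exp_ge_one_plus_x_over_n_power_n) (auto intro: order_trans[of _ 0])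
    finally have "(k / d) ^ k * (d * \<bar>x\<bar> / k) ^ k \<le> (k / d) ^ k * exp (d * \<bar>x\<bar>)"
      using assms by (intro mult_left_mono) auto
    moreover have "(k / d) ^ k * (d * \<bar>x\<bar> / k) ^ k = \<bar>x\<bar> ^ k"
      using False assms by (simp add: power_mult_distrib[symmetric])
    ultimately show ?thesis by simp
  qed
  then show ?thesis
    using False assms by (intro exI[of _ "(k / d) ^ k"]) auto
qed

text \<open>Differentiation under the integral through an explicit quadratic remainder. The weight
  takes values in a general normed field, so that one argument yields both real derivatives of
  moments and holomorphy of complex transforms.\<close>

lemma
  fixes w :: "real \<Rightarrow> 'a::{real_normed_field,banach,second_countable_topology}"
  assumes M[measurable_cong]: "sets M = sets borel"
    and w[measurable]: "w \<in> borel_measurable M"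
    and e: "e > 0"
    and int: "integrable M (\<lambda>x. exp (e * \<bar>x\<bar>) * norm (w x))"
  shows integrable_power_weight: "integrable M (\<lambda>x. of_real x ^ k * w x)"
    and has_field_derivative_integral_exp_weight:
      "((\<lambda>h. \<integral>x. of_real x ^ k * (exp (h * of_real x) * w x) \<partial>M)
         has_field_derivative (\<integral>x. of_real x ^ Suc k * w x \<partial>M)) (at 0)"
proof -
  \<comment> \<open>One half of the exponential margin e absorbs \<open>exp (h * of_real x)\<close>,
    the other half absorbs the powers of x.\<close>
  define d where "d = e / 2"
  have d: "d > 0" "e = d + d" using e by (auto simp: d_def)
  have ee: "exp (e * \<bar>x\<bar>) = exp (d * \<bar>x\<bar>) * exp (d * \<bar>x\<bar>)" for x :: real
    by (simp add: exp_add[symmetric] d(2) algebra_simps)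
  have I: "integrable M (\<lambda>x. of_real x ^ j * (exp (h * of_real x) * w x))" if h: "norm h \<le> d" for h j
  proof -
    obtain C where C: "C > 0" "\<And>x::real. \<bar>x\<bar> ^ j \<le> C * exp (d * \<bar>x\<bar>)"
      using abs_power_le_exp[OF d(1)] by blast
    show ?thesis
    proof (rule Bochner_Integration.integrable_bound)
      show "integrable M (\<lambda>x. C * (exp (e * \<bar>x\<bar>) * norm (w x)))" using int by simp
      show "AE x in M. norm (of_real x ^ j * (exp (h * of_real x) * w x))
              \<le> norm (C * (exp (e * \<bar>x\<bar>) * norm (w x)))"
      proof (rule AE_I2)
        fix x
        have "norm (exp (h * of_real x)) \<le> exp (norm (h * of_real x))" by (rule norm_exp)
        also have "\<dots> \<le> exp (d * \<bar>x\<bar>)" using h by (auto simp: norm_mult intro!: mult_right_mono)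
        finally have "\<bar>x\<bar> ^ j * (norm (exp (h * of_real x)) * norm (w x))
            \<le> (C * exp (d * \<bar>x\<bar>)) * (exp (d * \<bar>x\<bar>) * norm (w x))"
          using C by (intro mult_mono) auto
        then show "norm (of_real x ^ j * (exp (h * of_real x) * w x))
              \<le> norm (C * (exp (e * \<bar>x\<bar>) * norm (w x)))"
          using C by (simp add: norm_mult norm_power ee mult_ac)
      qed
    qed measurable
  qed
  from I[of 0 k] d show "integrable M (\<lambda>x. of_real x ^ k * w x)" by simp
  let ?F = "\<lambda>h. \<integral>x. of_real x ^ k * (exp (h * of_real x) * w x) \<partial>M"
  let ?D = "\<integral>x. of_real x ^ Suc k * w x \<partial>M"
  have ID: "integrable M (\<lambda>x. of_real x ^ Suc k * w x)" using I[of 0 "Suc k"] d by simp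
  \<comment> \<open>The exponent k + 2 joins the k powers of the integrand with the two powers of x
    from the Taylor remainder.\<close>
  obtain C where C: "C > 0" "\<And>x::real. \<bar>x\<bar> ^ (k + 2) \<le> C * exp (d * \<bar>x\<bar>)"
    using abs_power_le_exp[OF d(1)] by blast
  define K where "K = (\<integral>x. C * (exp (e * \<bar>x\<bar>) * norm (w x)) \<partial>M)"
  \<comment> \<open>K does not depend on h, so after division by h the error is of order
    |h|.\<close>
  have B: "norm (?F h - ?F 0 - h * ?D) \<le> (norm h)\<^sup>2 * K" if h: "norm h \<le> d" for h
  proof -
    have "?F h - ?F 0 - h * ?D = (\<integral>x. of_real x ^ k * (exp (h * of_real x) * w x)
        - of_real x ^ k * (exp (0 * of_real x) * w x) - h * (of_real x ^ Suc k * w x) \<partial>M)"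
      using I[OF h, of k] I[of 0 k] ID d by simp
    also have "\<dots> = (\<integral>x. of_real x ^ k * ((exp (h * of_real x) - 1 - h * of_real x) * w x) \<partial>M)"
      by (intro Bochner_Integration.integral_cong) (auto simp: algebra_simps)
    finally have eq: "?F h - ?F 0 - h * ?D = \<dots>" .
    have "norm (?F h - ?F 0 - h * ?D) \<le> (\<integral>x. (norm h)\<^sup>2 * (C * (exp (e * \<bar>x\<bar>) * norm (w x))) \<partial>M)"
      unfolding eq
    proof (rule Bochner_Integration.integral_norm_bound_integral)
      have "integrable M (\<lambda>x. of_real x ^ k * (exp (h * of_real x) * w x)
        - of_real x ^ k * (exp (0 * of_real x) * w x) - h * (of_real x ^ Suc k * w x))"
        using I[OF h, of k] I[of 0 k] ID d by (intro Bochner_Integration.integrable_diff integrable_mult_right) auto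
      then show "integrable M (\<lambda>x. of_real x ^ k * ((exp (h * of_real x) - 1 - h * of_real x) * w x))"
        by (rule Bochner_Integration.integrable_cong[THEN iffD1, rotated 2]) (auto simp: algebra_simps)
      show "integrable M (\<lambda>x. (norm h)\<^sup>2 * (C * (exp (e * \<bar>x\<bar>) * norm (w x))))"
        using int by simp
      fix x
      have "norm (exp (h * of_real x) - 1 - h * of_real x)
          \<le> exp (norm (h * of_real x)) * norm (h * of_real x) ^ Suc 1 / fact 1"
        using Taylor_exp_field[of "h * of_real x" 1] by (simp add: algebra_simps)
      also have "\<dots> = exp (norm h * \<bar>x\<bar>) * ((norm h)\<^sup>2 * \<bar>x\<bar>\<^sup>2)"
        by (simp add: norm_mult power_mult_distrib power2_eq_square mult_ac)
      also have "\<dots> \<le> exp (d * \<bar>x\<bar>) * ((norm h)\<^sup>2 * \<bar>x\<bar>\<^sup>2)"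
        using h by (intro mult_right_mono) (auto intro!: mult_right_mono)
      finally have *: "norm (exp (h * of_real x) - 1 - h * of_real x) * norm (w x)
          \<le> exp (d * \<bar>x\<bar>) * ((norm h)\<^sup>2 * \<bar>x\<bar>\<^sup>2) * norm (w x)"
        by (intro mult_right_mono) auto
      have "norm (of_real x ^ k * ((exp (h * of_real x) - 1 - h * of_real x) * w x))
        = \<bar>x\<bar> ^ k * (norm (exp (h * of_real x) - 1 - h * of_real x) * norm (w x))"
        by (simp add: norm_mult norm_power)
      also have "\<dots> \<le> \<bar>x\<bar> ^ k * (exp (d * \<bar>x\<bar>) * ((norm h)\<^sup>2 * \<bar>x\<bar>\<^sup>2) * norm (w x))"
        using * by (intro mult_left_mono) auto
      also have "\<dots> = \<bar>x\<bar> ^ (k + 2) * ((norm h)\<^sup>2 * (exp (d * \<bar>x\<bar>) * norm (w x)))"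
        by (simp add: power_add power2_eq_square mult_ac)
      also have "\<dots> \<le> (C * exp (d * \<bar>x\<bar>)) * ((norm h)\<^sup>2 * (exp (d * \<bar>x\<bar>) * norm (w x)))"
        using C(2) by (intro mult_right_mono) auto
      also have "\<dots> = (norm h)\<^sup>2 * (C * (exp (e * \<bar>x\<bar>) * norm (w x)))"
        by (simp add: ee mult_ac)
      finally show "norm (of_real x ^ k * ((exp (h * of_real x) - 1 - h * of_real x) * w x))
        \<le> (norm h)\<^sup>2 * (C * (exp (e * \<bar>x\<bar>) * norm (w x)))" .
    qed
    then show ?thesis by (simp add: K_def)
  qed
  have "((\<lambda>h. (?F h - ?F 0) / h - ?D) \<longlongrightarrow> 0) (at 0)"
  proof (rule Lim_null_comparison)
    show "\<forall>\<^sub>F h in at 0. norm ((?F h - ?F 0) / h - ?D) \<le> norm h * K"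
      unfolding eventually_at
    proof (intro exI[of _ d] conjI ballI impI)
      fix h :: 'a assume h: "h \<noteq> 0 \<and> dist h 0 < d"
      then have "norm ((?F h - ?F 0) / h - ?D) = norm (?F h - ?F 0 - h * ?D) / norm h"
        by (simp add: norm_divide[symmetric] divide_simps mult_ac)
      also have "\<dots> \<le> (norm h)\<^sup>2 * K / norm h"
        using B[of h] h by (intro divide_right_mono) auto
      finally show "norm ((?F h - ?F 0) / h - ?D) \<le> norm h * K"
        using h by (simp add: power2_eq_square)
    qed (use d in auto)
    show "((\<lambda>h. norm h * K) \<longlongrightarrow> 0) (at (0::'a))"
      by (auto intro!: tendsto_eq_intros)
  qed
  then show "(?F has_field_derivative ?D) (at 0)"
    unfolding DERIV_def using LIM_zero_iff by fastforce
qed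

text \<open>Openness leaves some room e on both sides of \<theta>, and the integrand is at most the
  sum of the exponentials at \<theta> - e and \<theta> + e, one for each sign of x.\<close>

lemma integrable_exp_abs_weight:
  fixes \<theta> :: real
  assumes M[measurable_cong]: "sets M = sets borel"
    and fin: "\<And>t. t \<in> S \<Longrightarrow> laplace M t < \<infinity>"
    and S: "open S" "\<theta> \<in> S"
  shows "\<exists>e>0. integrable M (\<lambda>x. exp (e * \<bar>x\<bar>) * exp (x * \<theta>))"
proof -
  obtain e where e: "e > 0" "cball \<theta> e \<subseteq> S" using S open_contains_cball by blast
  have *: "integrable M (\<lambda>x. exp (x * t))" if "t \<in> S" for t
    using fin[OF that] by (intro integrableI_nonneg) (auto simp: laplace_def)
  have "\<theta> - e \<in> S" "\<theta> + e \<in> S" using e by (auto simp: subset_iff dist_real_def)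
  then have "integrable M (\<lambda>x. exp (x * (\<theta> - e)) + exp (x * (\<theta> + e)))"
    by (intro Bochner_Integration.integrable_add *)
  then have "integrable M (\<lambda>x. exp (e * \<bar>x\<bar>) * exp (x * \<theta>))"
  proof (rule Bochner_Integration.integrable_bound)
    show "AE x in M. norm (exp (e * \<bar>x\<bar>) * exp (x * \<theta>))
             \<le> norm (exp (x * (\<theta> - e)) + exp (x * (\<theta> + e)))"
    proof (rule AE_I2)
      fix x :: real
      show "norm (exp (e * \<bar>x\<bar>) * exp (x * \<theta>)) \<le> norm (exp (x * (\<theta> - e)) + exp (x * (\<theta> + e)))"
        by (cases "x \<ge> 0") (auto simp: exp_add[symmetric] algebra_simps)
    qed
  qed measurable
  with e show ?thesis by blast
qed

text \<open>The norm condition expresses that z has real part \<theta>, in a form common to the real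
  and the complex field. Taking \<open>exp (z * of_real x)\<close> as the weight moves the
  differentiation from z to 0.\<close>

lemma laplace_has_derivative:
  fixes z :: "'a::{real_normed_field,banach,second_countable_topology}" and \<theta> :: real
  assumes M[measurable_cong]: "sets M = sets borel"
    and fin: "\<And>t. t \<in> S \<Longrightarrow> laplace M t < \<infinity>"
    and S: "open S" "\<theta> \<in> S"
    and z: "\<And>x. norm (exp (z * of_real x)) = exp (x * \<theta>)"
  shows "integrable M (\<lambda>x. of_real x ^ k * exp (z * of_real x))"
    and "((\<lambda>z. \<integral>x. of_real x ^ k * exp (z * of_real x) \<partial>M) has_field_derivative
          (\<integral>x. of_real x ^ Suc k * exp (z * of_real x) \<partial>M)) (at z)"
proof -
  obtain e where e: "e > 0" "integrable M (\<lambda>x. exp (e * \<bar>x\<bar>) * exp (x * \<theta>))"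
    using integrable_exp_abs_weight[OF M fin S] by blast
  have meas: "(\<lambda>x. exp (z * of_real x)) \<in> borel_measurable M"
    by measurable
  have int: "integrable M (\<lambda>x. exp (e * \<bar>x\<bar>) * norm (exp (z * of_real x)))"
    using e(2) by (simp add: z)
  show "integrable M (\<lambda>x. of_real x ^ k * exp (z * of_real x))"
    by (rule integrable_power_weight[OF M meas e(1) int])
  have "((\<lambda>h. \<integral>x. of_real x ^ k * (exp (h * of_real x) * exp (z * of_real x)) \<partial>M)
         has_field_derivative (\<integral>x. of_real x ^ Suc k * exp (z * of_real x) \<partial>M)) (at 0)"
    by (rule has_field_derivative_integral_exp_weight[OF M meas e(1) int])
  also have "(\<lambda>h. \<integral>x. of_real x ^ k * (exp (h * of_real x) * exp (z * of_real x)) \<partial>M)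
      = (\<lambda>h. \<integral>x. of_real x ^ k * exp ((h + z) * of_real x) \<partial>M)"
    by (simp add: exp_add[symmetric] distrib_right)
  finally show "((\<lambda>z. \<integral>x. of_real x ^ k * exp (z * of_real x) \<partial>M) has_field_derivative
          (\<integral>x. of_real x ^ Suc k * exp (z * of_real x) \<partial>M)) (at z)"
    using DERIV_shift[of "\<lambda>z. \<integral>x. of_real x ^ k * exp (z * of_real x) \<partial>M" _ 0 z] by simp
qed

text \<open>Both transforms extend holomorphically to a vertical strip, where the identity theorem
  makes them equal. On the line with real part \<theta> they are, up to a factor, characteristic
  functions of exponentially tilted measures, so Levy's uniqueness theorem applies, and the tilting
  is then undone.\<close>

lemma laplace_unique:
  assumes M[measurable_cong]: "sets M = sets borel" and N[measurable_cong]: "sets N = sets borel"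
    and S: "open S" "S \<noteq> {}"
    and fin: "\<And>t. t \<in> S \<Longrightarrow> laplace M t < \<infinity>"
    and eq: "\<And>t. t \<in> S \<Longrightarrow> laplace M t = laplace N t"
  shows "M = N"
proof -
  obtain \<theta> where \<theta>: "\<theta> \<in> S" using S by blast
  obtain e where e: "e > 0" "ball \<theta> e \<subseteq> S" using S(1) \<theta> open_contains_ball by blast
  \<comment> \<open>S may be disconnected. The strip above an interval inside S is connected, as the
    identity theorem requires.\<close>
  define R where "R = {\<theta> - e<..<\<theta> + e}"
  have R: "open R" "R \<subseteq> S" "\<theta> \<in> R"
    using e by (auto simp: R_def subset_iff dist_real_def)
  define F where "F = (\<lambda>M z. \<integral>x. exp (z * complex_of_real x) \<partial>M)"
  define T where "T = {z. Re z \<in> R}"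
  have T_eq: "T = {z. Re z < \<theta> + e} \<inter> {z. Re z > \<theta> - e}" by (auto simp: T_def R_def)
  have T: "open T" "connected T" unfolding T_eq
    by (intro open_Int open_halfspace_Re_lt open_halfspace_Re_gt convex_connected convex_Int
        convex_halfspace_Re_lt convex_halfspace_Re_gt)+
  have nrm: "norm (exp (z * complex_of_real x)) = exp (x * Re z)" for z x
    by (simp add: mult_ac)
  have hol: "F P holomorphic_on T" if P: "sets P = sets borel" "\<And>t. t \<in> R \<Longrightarrow> laplace P t < \<infinity>" for P
    unfolding F_def holomorphic_on_open[OF T(1)]
    using laplace_has_derivative(2)[OF P R(1) _ nrm, where k = 0] by (auto simp: T_def)
  have finR: "laplace M t < \<infinity>" "laplace N t < \<infinity>" if "t \<in> R" for t
    using fin eq that R by (auto simp: subset_iff)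
  have real_val: "F P (of_real t) = of_real (enn2real (laplace P t))" if P: "sets P = sets borel" for P t
  proof -
    have [measurable_cong]: "sets P = sets borel" by (rule P)
    have "F P (of_real t) = (\<integral>x. complex_of_real (exp (x * t)) \<partial>P)"
      unfolding F_def by (simp add: exp_of_real[symmetric] mult_ac)
    also have "\<dots> = of_real (\<integral>x. exp (x * t) \<partial>P)" by (rule integral_complex_of_real)
    also have "(\<integral>x. exp (x * t) \<partial>P) = enn2real (laplace P t)"
      unfolding laplace_def by (intro integral_eq_nn_integral) auto
    finally show ?thesis .
  qed
  have FMN: "F M z = F N z" if z: "z \<in> T" for z
  proof -
    have "F M z - F N z = 0"
    proof (rule analytic_continuation[OF _ T, of "\<lambda>z. F M z - F N z" "of_real ` R" "of_real \<theta>"])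
      show "(\<lambda>z. F M z - F N z) holomorphic_on T"
        using finR M N by (intro holomorphic_intros hol) auto
      show "complex_of_real ` R \<subseteq> T" by (auto simp: T_def)
      show "complex_of_real \<theta> \<in> T" using R by (auto simp: T_def)
      show "complex_of_real \<theta> islimpt complex_of_real ` R"
      proof (subst islimpt_approachable, intro allI impI)
        fix d :: real assume "d > 0"
        \<comment> \<open>A point of the interval different from \<theta> and closer than d, so that
          \<theta> is a limit point of the real segment on which the transforms agree.\<close>
        define t where "t = \<theta> + min d e / 2"
        have "t \<in> R" "t \<noteq> \<theta>" "\<bar>t - \<theta>\<bar> < d" using \<open>d > 0\<close> e by (auto simp: R_def t_def)
        then show "\<exists>x'\<in>complex_of_real ` R. x' \<noteq> complex_of_real \<theta> \<and> dist x' (complex_of_real \<theta>) < d"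
          by (intro bexI[of _ "complex_of_real t"])
             (auto simp: dist_norm of_real_diff[symmetric] simp del: of_real_diff)
      qed
      show "F M z - F N z = 0" if "z \<in> complex_of_real ` R" for z
        using that R eq M N by (auto simp: real_val)
    qed (use z in auto)
    then show ?thesis by simp
  qed
  define m where "m = enn2real (laplace M \<theta>)"
  have m: "laplace M \<theta> = ennreal m" "laplace N \<theta> = ennreal m" "m \<ge> 0"
    using finR[OF R(3)] eq[OF \<theta>] by (auto simp: m_def)
  show ?thesis
  proof (cases "m = 0")
    \<comment> \<open>No normalisation is possible here, but exponentials are positive, so a
      transform vanishing at \<theta> forces the zero measure.\<close>
    case True
    have "emeasure P (space P) = 0" if P: "sets P = sets borel" "laplace P \<theta> = 0" for P
    proof -
      have [measurable_cong]: "sets P = sets borel" by (rule P)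
      have "AE x in P. ennreal (exp (x * \<theta>)) = 0"
        using P(2) unfolding laplace_def by (subst (asm) nn_integral_0_iff_AE) auto
      then have "AE x in P. False" by (rule AE_mp) (intro AE_I2, auto)
      then show ?thesis
        using AE_iff_measurable[of "space P" P "\<lambda>x. False"] by auto
    qed
    then have z: "emeasure M (space M) = 0" "emeasure N (space N) = 0" using m True M N by auto
    show ?thesis
    proof (rule measure_eqI)
      show "sets M = sets N" using M N by simp
      fix A assume "A \<in> sets M"
      with M N have "A \<in> sets M" "A \<in> sets N" by auto
      then have "emeasure M A \<le> emeasure M (space M)" "emeasure N A \<le> emeasure N (space N)"
        by (auto intro!: emeasure_space)
      then show "emeasure M A = emeasure N A" using z by simp
    qed
  next
    case False
    with m have mpos: "m > 0" by simp
    \<comment> \<open>Exponential tilting at \<theta>, divided by its total mass m, gives a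
      probability measure even if the original measure is infinite.\<close>
    define G where "G = (\<lambda>P. density P (\<lambda>x. ennreal (exp (x * \<theta>) / m)))"
    have dist: "real_distribution (G P)" if P: "sets P = sets borel" "laplace P \<theta> = ennreal m" for P
    proof -
      have [measurable_cong]: "sets P = sets borel" by (rule P)
      have "emeasure (G P) (space (G P)) = (\<integral>\<^sup>+x. ennreal (exp (x * \<theta>) / m) \<partial>P)"
        unfolding G_def by (simp add: emeasure_density)
      also have "\<dots> = (\<integral>\<^sup>+x. ennreal (1 / m) * ennreal (exp (x * \<theta>)) \<partial>P)"
        using mpos by (simp add: ennreal_mult'[symmetric])
      also have "\<dots> = ennreal (1 / m) * laplace P \<theta>"
        unfolding laplace_def by (rule nn_integral_cmult) measurable
      also have "\<dots> = 1" using mpos P by (simp add: ennreal_mult'[symmetric])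
      finally have "prob_space (G P)" by (rule prob_spaceI)
      then show ?thesis
        using P by (auto simp: real_distribution_def real_distribution_axioms_def G_def)
    qed
    \<comment> \<open>The imaginary part of the argument of F becomes the frequency of the
      characteristic function.\<close>
    have ch: "char (G P) t = F P (Complex \<theta> t) / m" if P: "sets P = sets borel" for P t
    proof -
      have [measurable_cong]: "sets P = sets borel" by (rule P)
      have "char (G P) t = (\<integral>x. (exp (x * \<theta>) / m) *\<^sub>R iexp (t * x) \<partial>P)"
        unfolding char_def G_def using mpos by (subst integral_density) auto
      also have "\<dots> = (\<integral>x. exp (Complex \<theta> t * of_real x) / m \<partial>P)"
      proof (rule Bochner_Integration.integral_cong[OF refl])
        fix x
        have "Complex \<theta> t * of_real x = of_real (x * \<theta>) + \<i> * of_real (t * x)"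
          by (simp add: complex_eq_iff)
        then show "(exp (x * \<theta>) / m) *\<^sub>R iexp (t * x) = exp (Complex \<theta> t * of_real x) / m"
          by (simp only: exp_add exp_of_real) (simp add: scaleR_conv_of_real)
      qed
      also have "\<dots> = F P (Complex \<theta> t) / m" unfolding F_def by simp
      finally show ?thesis .
    qed
    have "char (G M) = char (G N)"
    proof
      fix t
      have "Complex \<theta> t \<in> T" using R by (simp add: T_def)
      then show "char (G M) t = char (G N) t" using ch M N FMN by auto
    qed
    then have GG: "G M = G N" using dist M N m by (intro Levy_uniqueness) auto
    \<comment> \<open>The tilting density is positive and finite everywhere, so its reciprocal
      recovers the measure.\<close>
    have undo: "density (G P) (\<lambda>x. ennreal (m / exp (x * \<theta>))) = P" if P: "sets P = sets borel" for P
    proof -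
      have [measurable_cong]: "sets P = sets borel" by (rule P)
      have "density (G P) (\<lambda>x. ennreal (m / exp (x * \<theta>)))
        = density P (\<lambda>x. ennreal (exp (x * \<theta>) / m) * ennreal (m / exp (x * \<theta>)))"
        unfolding G_def by (rule density_density_eq) measurable
      also have "\<dots> = density P (\<lambda>x. 1)"
        using mpos by (intro density_cong) (auto simp: ennreal_mult'[symmetric])
      finally show ?thesis by (simp add: density_1)
    qed
    show ?thesis using trans[OF undo[OF M, unfolded GG, symmetric] undo[OF N]] .
  qed
qed

section \<open>Natural exponential families\<close>

locale nef =
  fixes \<beta> :: "real measure"
  assumes basis: "nef_basis \<beta>"
begin

section \<open>Sigma-finiteness of the basis and shape of its domain\<close>

lemma sets_basis[measurable_cong]: "sets \<beta> = sets borel"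
  using basis by (simp add: nef_basis_def radon_measure_on_reals_def)

sublocale sigma_finite_measure \<beta>
proof
  show "\<exists>A. countable A \<and> A \<subseteq> sets \<beta> \<and> \<Union> A = space \<beta> \<and> (\<forall>a\<in>A. emeasure \<beta> a \<noteq> \<infinity>)"
  proof (intro exI[of _ "range (\<lambda>n::nat. {- real n..real n})"] conjI)
    have "x \<in> (\<Union>n::nat. {- real n..real n})" for x
    proof -
      obtain n where "\<bar>x\<bar> \<le> real n" using real_arch_simple by blast
      then have "x \<in> {- real n..real n}" by auto
      then show ?thesis by blast
    qed
    then show "(\<Union>n::nat. {- real n..real n}) = space \<beta>"
      using sets_eq_imp_space_eq[OF sets_basis] by auto
    show "\<forall>a\<in>range (\<lambda>n::nat. {- real n..real n}). emeasure \<beta> a \<noteq> \<infinity>"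
    proof -
      have "\<forall>K. compact K \<longrightarrow> emeasure \<beta> K < \<infinity>"
        using basis by (simp add: nef_basis_def radon_measure_on_reals_def)
      then have "emeasure \<beta> {- real n..real n} < \<infinity>" for n :: nat
        using compact_Icc by blast
      then show ?thesis by (auto simp: less_top)
    qed
  qed (auto simp: sets_basis)
qed

lemma open_domain: "open (nef_domain \<beta>)"
  by (simp add: nef_domain_def)

lemma domain_nonempty: "nef_domain \<beta> \<noteq> {}"
  using basis by (simp add: nef_basis_def)

lemma laplace_finite: "\<theta> \<in> nef_domain \<beta> \<Longrightarrow> laplace \<beta> \<theta> < \<infinity>"
  using interior_subset by (auto simp: nef_domain_def)

text \<open>For t between s and u, the product x t is at most x s or at most x u, according to the
  sign of x, so the transform at t is bounded by the sum of those at s and u. Convexity later turns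
  local statements about derivatives into global ones.\<close>

lemma convex_domain: "convex (nef_domain \<beta>)"
  unfolding nef_domain_def
proof (rule convex_interior)
  show "convex {\<theta>. laplace \<beta> \<theta> < \<infinity>}"
    unfolding is_interval_convex_1[symmetric] is_interval_1
  proof (intro allI ballI impI, elim conjE)
    fix s u t :: real
    assume "s \<in> {\<theta>. laplace \<beta> \<theta> < \<infinity>}" "u \<in> {\<theta>. laplace \<beta> \<theta> < \<infinity>}" and st: "s \<le> t" "t \<le> u"
    then have fin: "laplace \<beta> s + laplace \<beta> u < \<infinity>" by simp
    have "laplace \<beta> t \<le> (\<integral>\<^sup>+x. ennreal (exp (x * s)) + ennreal (exp (x * u)) \<partial>\<beta>)"
      unfolding laplace_def
    proof (rule nn_integral_mono)
      fix x :: real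
      have "x * t \<le> x * s \<or> x * t \<le> x * u"
        using st by (cases "x \<ge> 0") (auto intro: mult_left_mono mult_left_mono_neg)
      then have "exp (x * t) \<le> exp (x * s) + exp (x * u)"
        by (auto intro: order_trans[of _ "exp (x * s)"] order_trans[of _ "exp (x * u)"])
      then show "ennreal (exp (x * t)) \<le> ennreal (exp (x * s)) + ennreal (exp (x * u))"
        by (simp add: ennreal_plus[symmetric] del: ennreal_plus)
    qed
    also have "\<dots> = laplace \<beta> s + laplace \<beta> u"
      unfolding laplace_def by (rule nn_integral_add) measurable
    finally show "t \<in> {\<theta>. laplace \<beta> \<theta> < \<infinity>}" using fin by (simp add: le_less_trans)
  qed
qed

section \<open>Moments, mean and variance as functions of the parameter\<close>

definition exp_moment :: "nat \<Rightarrow> real \<Rightarrow> real" where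
  "exp_moment k \<theta> = (\<integral>x. x ^ k * exp (\<theta> * x) \<partial>\<beta>)"

text \<open>The real instance of \<open>laplace_has_derivative\<close>: on the domain,
  \<open>exp_moment k\<close> is the k-th derivative of the Laplace transform
  \<open>exp_moment 0\<close>.\<close>

lemma
  assumes "\<theta> \<in> nef_domain \<beta>"
  shows integrable_exp_moment: "integrable \<beta> (\<lambda>x. x ^ k * exp (\<theta> * x))"
    and DERIV_exp_moment: "(exp_moment k has_real_derivative exp_moment (Suc k) \<theta>) (at \<theta>)"
proof -
  have *: "norm (exp (\<theta> * of_real x)) = exp (x * \<theta>)" for x by (simp add: mult.commute)
  note L = laplace_has_derivative[OF sets_basis laplace_finite open_domain assms *, of k]
  from L(1) show "integrable \<beta> (\<lambda>x. x ^ k * exp (\<theta> * x))" by simp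
  from L(2) show "(exp_moment k has_real_derivative exp_moment (Suc k) \<theta>) (at \<theta>)"
    unfolding exp_moment_def[abs_def] by simp
qed

text \<open>A zero integral would concentrate \<beta> on c. This is where the non-degeneracy of the
  basis enters, both for a positive Laplace transform and for a positive variance.\<close>

lemma integral_pos_basis:
  assumes int: "integrable \<beta> f" and f: "\<And>x. f x \<ge> 0" "\<And>x. f x = 0 \<Longrightarrow> x = c"
  shows "(\<integral>x. f x \<partial>\<beta>) > (0::real)"
proof -
  have "(\<integral>x. f x \<partial>\<beta>) \<noteq> 0"
  proof
    assume "(\<integral>x. f x \<partial>\<beta>) = 0"
    then have "AE x in \<beta>. f x = 0"
      using integral_nonneg_eq_0_iff_AE[OF int] f by auto
    then have "AE x in \<beta>. x = c" by eventually_elim (rule f)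
    then show False using basis by (auto simp: nef_basis_def)
  qed
  moreover have "(\<integral>x. f x \<partial>\<beta>) \<ge> 0" using f by (intro Bochner_Integration.integral_nonneg) auto
  ultimately show ?thesis by simp
qed

lemma exp_moment_0_pos: "\<theta> \<in> nef_domain \<beta> \<Longrightarrow> exp_moment 0 \<theta> > 0"
  using integral_pos_basis[OF integrable_exp_moment[of \<theta> 0]] by (simp add: exp_moment_def)

lemma laplace_eq: "\<theta> \<in> nef_domain \<beta> \<Longrightarrow> laplace \<beta> \<theta> = ennreal (exp_moment 0 \<theta>)"
  using nn_integral_eq_integral[OF integrable_exp_moment[of \<theta> 0]]
  by (simp add: exp_moment_def laplace_def mult.commute)

lemma cumulant_eq: "\<theta> \<in> nef_domain \<beta> \<Longrightarrow> cumulant \<beta> \<theta> = ln (exp_moment 0 \<theta>)"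
  using exp_moment_0_pos[of \<theta>] by (simp add: cumulant_def laplace_eq)

lemma nef_member_eq:
  assumes "\<theta> \<in> nef_domain \<beta>"
  shows "nef_member \<beta> \<theta> = density \<beta> (\<lambda>x. ennreal (exp (\<theta> * x) / exp_moment 0 \<theta>))"
  using exp_moment_0_pos[OF assms] by (simp add: nef_member_def cumulant_eq assms exp_diff)

lemma integral_nef_member:
  assumes "\<theta> \<in> nef_domain \<beta>" and [measurable]: "f \<in> borel_measurable borel"
  shows "(\<integral>x. f x \<partial>nef_member \<beta> \<theta>) = (\<integral>x. f x * exp (\<theta> * x) \<partial>\<beta>) / exp_moment 0 \<theta>"
proof -
  have "(\<integral>x. f x \<partial>nef_member \<beta> \<theta>) = (\<integral>x. (exp (\<theta> * x) / exp_moment 0 \<theta>) *\<^sub>R f x \<partial>\<beta>)"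
    using exp_moment_0_pos[OF assms(1)]
    unfolding nef_member_eq[OF assms(1)] by (intro integral_density) auto
  also have "\<dots> = (\<integral>x. (f x * exp (\<theta> * x)) / exp_moment 0 \<theta> \<partial>\<beta>)"
    by (simp add: mult.commute)
  finally show ?thesis by simp
qed

lemma mean_function_eq:
  "\<theta> \<in> nef_domain \<beta> \<Longrightarrow> mean_function \<beta> \<theta> = exp_moment 1 \<theta> / exp_moment 0 \<theta>"
  by (simp add: mean_function_def integral_nef_member exp_moment_def)

text \<open>Parametrised by \<theta> instead of the mean, so that the inverse of the mean function
  enters only in \<open>variance_function_mean\<close>.\<close>

definition nef_variance :: "real \<Rightarrow> real" where
  "nef_variance \<theta> = (\<integral>x. (x - mean_function \<beta> \<theta>)\<^sup>2 \<partial>nef_member \<beta> \<theta>)"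

lemma nef_variance_eq:
  assumes \<theta>: "\<theta> \<in> nef_domain \<beta>"
  shows "nef_variance \<theta> = exp_moment 2 \<theta> / exp_moment 0 \<theta> - (mean_function \<beta> \<theta>)\<^sup>2"
proof -
  let ?m = "mean_function \<beta> \<theta>"
  note int = integrable_exp_moment[OF \<theta>]
  have "(\<integral>x. (x - ?m)\<^sup>2 * exp (\<theta> * x) \<partial>\<beta>)
     = (\<integral>x. x ^ 2 * exp (\<theta> * x) - (2 * ?m) * (x ^ 1 * exp (\<theta> * x)) + ?m\<^sup>2 * (x ^ 0 * exp (\<theta> * x)) \<partial>\<beta>)"
    by (intro Bochner_Integration.integral_cong) (auto simp: power2_eq_square algebra_simps)
  also have "\<dots> = exp_moment 2 \<theta> - 2 * ?m * exp_moment 1 \<theta> + ?m\<^sup>2 * exp_moment 0 \<theta>"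
    unfolding exp_moment_def
    using int[of 2] int[of 1] int[of 0]
    by (simp del: power_0 power_one_right power_Suc)
  also have "exp_moment 1 \<theta> = ?m * exp_moment 0 \<theta>"
    using exp_moment_0_pos[OF \<theta>] by (simp add: mean_function_eq \<theta>)
  finally show ?thesis
    using exp_moment_0_pos[OF \<theta>]
    by (simp add: nef_variance_def integral_nef_member \<theta> field_simps power2_eq_square)
qed

text \<open>The integrand \<open>(x - ?m)\<^sup>2 * exp (\<theta> * x)\<close> vanishes only at the
  mean, a single point.\<close>

lemma nef_variance_pos:
  assumes \<theta>: "\<theta> \<in> nef_domain \<beta>"
  shows "nef_variance \<theta> > 0"
proof -
  let ?m = "mean_function \<beta> \<theta>"
  note int = integrable_exp_moment[OF \<theta>]
  have "integrable \<beta> (\<lambda>x. x ^ 2 * exp (\<theta> * x) - (2 * ?m) * (x ^ 1 * exp (\<theta> * x)) + ?m\<^sup>2 * (x ^ 0 * exp (\<theta> * x)))"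
    using int[of 2] int[of 1] int[of 0]
    by (intro Bochner_Integration.integrable_add Bochner_Integration.integrable_diff integrable_mult_right)
  also have "(\<lambda>x. x ^ 2 * exp (\<theta> * x) - (2 * ?m) * (x ^ 1 * exp (\<theta> * x)) + ?m\<^sup>2 * (x ^ 0 * exp (\<theta> * x)))
     = (\<lambda>x. (x - ?m)\<^sup>2 * exp (\<theta> * x))"
    by (auto simp: power2_eq_square algebra_simps)
  finally have "(\<integral>x. (x - ?m)\<^sup>2 * exp (\<theta> * x) \<partial>\<beta>) > 0"
    by (rule integral_pos_basis[where c = ?m]) auto
  then show ?thesis
    using exp_moment_0_pos[OF \<theta>] by (simp add: nef_variance_def integral_nef_member \<theta>)
qed

lemma DERIV_cumulant:
  assumes \<theta>: "\<theta> \<in> nef_domain \<beta>"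
  shows "(cumulant \<beta> has_real_derivative mean_function \<beta> \<theta>) (at \<theta>)"
proof -
  have "((\<lambda>t. ln (exp_moment 0 t)) has_real_derivative mean_function \<beta> \<theta>) (at \<theta>)"
    using DERIV_exp_moment[OF \<theta>, of 0] exp_moment_0_pos[OF \<theta>]
    by (auto intro!: derivative_eq_intros simp: mean_function_eq \<theta>)
  \<comment> \<open>The formula with \<open>ln\<close> is available on the domain only; since the
    domain is open, this determines the derivative.\<close>
  then show ?thesis
    by (rule has_field_derivative_transform_within_open[OF _ open_domain \<theta>])
       (simp add: cumulant_eq)
qed

text \<open>The quotient rule for the first two moments gives the second moment minus the squared
  mean. With \<open>DERIV_cumulant\<close>, this identifies the second derivative of the cumulant
  with the variance.\<close>

lemma DERIV_mean_function:
  assumes \<theta>: "\<theta> \<in> nef_domain \<beta>"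
  shows "(mean_function \<beta> has_real_derivative nef_variance \<theta>) (at \<theta>)"
proof -
  have "((\<lambda>t. exp_moment 1 t / exp_moment 0 t) has_real_derivative nef_variance \<theta>) (at \<theta>)"
    using DERIV_exp_moment[OF \<theta>, of 0] DERIV_exp_moment[OF \<theta>, of 1] exp_moment_0_pos[OF \<theta>]
    by (auto intro!: derivative_eq_intros
        simp: mean_function_eq nef_variance_eq \<theta> field_simps power2_eq_square numeral_2_eq_2)
  then show ?thesis
    by (rule has_field_derivative_transform_within_open[OF _ open_domain \<theta>])
       (simp add: mean_function_eq)
qed

lemma deriv2_cumulant:
  assumes \<theta>: "\<theta> \<in> nef_domain \<beta>"
  shows "deriv (deriv (cumulant \<beta>)) \<theta> = nef_variance \<theta>"
proof (rule DERIV_imp_deriv)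
  show "(deriv (cumulant \<beta>) has_real_derivative nef_variance \<theta>) (at \<theta>)"
    by (rule has_field_derivative_transform_within_open[OF DERIV_mean_function[OF \<theta>] open_domain \<theta>])
       (simp add: DERIV_imp_deriv[OF DERIV_cumulant])
qed

text \<open>The derivative is a positive variance. The resulting injectivity makes
  \<open>inv_into\<close> a true inverse in \<open>variance_function\<close>.\<close>

lemma strict_mono_mean_function:
  assumes "s \<in> nef_domain \<beta>" "t \<in> nef_domain \<beta>" "s < t"
  shows "mean_function \<beta> s < mean_function \<beta> t"
proof (rule DERIV_pos_imp_increasing[OF \<open>s < t\<close>])
  fix x assume "s \<le> x" "x \<le> t"
  then have "x \<in> nef_domain \<beta>"
    using convex_domain assms unfolding is_interval_convex_1[symmetric] is_interval_1 by blast
  then show "\<exists>y. (mean_function \<beta> has_real_derivative y) (at x) \<and> 0 < y"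
    using DERIV_mean_function nef_variance_pos by blast
qed

section \<open>Power variance: explicit mean, variance and support of the basis\<close>

lemma variance_function_mean:
  assumes "\<theta> \<in> nef_domain \<beta>"
  shows "variance_function \<beta> (mean_function \<beta> \<theta>) = nef_variance \<theta>"
proof -
  have "inj_on (mean_function \<beta>) (nef_domain \<beta>)"
    using strict_mono_mean_function by (intro linorder_inj_onI') (metis less_irrefl)
  then show ?thesis
    using assms by (simp add: variance_function_def nef_variance_def inv_into_f_f)
qed

text \<open>The mean \<mu> solves the separable equation \<mu>' = a \<mu>^r. Integrating it gives
  the formula on the domain; surjectivity onto the positive half-line then shows that the domain is
  all of \<open>{..<c}\<close>.\<close>

lemma power_variance_solution:
  fixes a r :: real
  assumes a: "a > 0" and r: "r > 1"
    and dom: "mean_domain \<beta> = {0<..}"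
    and var: "\<forall>u\<in>mean_domain \<beta>. variance_function \<beta> u = a * u powr r"
  obtains K c where "K > 0" "nef_domain \<beta> = {..<c}"
    "\<And>\<theta>. \<theta> < c \<Longrightarrow> mean_function \<beta> \<theta> = K * (c - \<theta>) powr - (1 / (r - 1))"
    "\<And>\<theta>. \<theta> < c \<Longrightarrow> nef_variance \<theta> = a * K powr r * (c - \<theta>) powr - (r / (r - 1))"
proof -
  define b where "b = a * (r - 1)"
  have b: "b > 0" using a r by (simp add: b_def)
  let ?\<Theta> = "nef_domain \<beta>" and ?\<mu> = "mean_function \<beta>"
  have pos: "?\<mu> \<theta> > 0" if "\<theta> \<in> ?\<Theta>" for \<theta>
    using dom that by (auto simp: mean_domain_def)
  have V: "nef_variance \<theta> = a * ?\<mu> \<theta> powr r" if "\<theta> \<in> ?\<Theta>" for \<theta>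
    using var that by (auto simp: mean_domain_def variance_function_mean)
  \<comment> \<open>A first integral: the derivative of \<open>?\<mu> \<theta> powr (1 - r)\<close>
    is (1 - r) a = - b, which the summand \<theta> cancels after division by b. Its constant value c
    becomes the right endpoint of the domain.\<close>
  have "\<exists>c. \<forall>\<theta>\<in>?\<Theta>. ?\<mu> \<theta> powr (1 - r) / b + \<theta> = c"
  proof (rule has_field_derivative_zero_constant[OF convex_domain])
    fix \<theta> assume \<theta>: "\<theta> \<in> ?\<Theta>"
    have "((\<lambda>\<theta>. ?\<mu> \<theta> powr (1 - r)) has_real_derivative
            (1 - r) * ?\<mu> \<theta> powr (1 - r - 1) * (a * ?\<mu> \<theta> powr r)) (at \<theta>)"
      using DERIV_fun_powr[OF DERIV_mean_function[OF \<theta>] pos[OF \<theta>], of "1 - r"] V[OF \<theta>] by simp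
    also have "(1 - r) * ?\<mu> \<theta> powr (1 - r - 1) * (a * ?\<mu> \<theta> powr r)
        = (1 - r) * a * (?\<mu> \<theta> powr (- r) * ?\<mu> \<theta> powr r)" by simp
    also have "\<dots> = - b" using pos[OF \<theta>] by (simp add: powr_add[symmetric] b_def algebra_simps)
    finally have "((\<lambda>\<theta>. ?\<mu> \<theta> powr (1 - r) / b + \<theta>) has_real_derivative - b / b + 1) (at \<theta>)"
      by (intro DERIV_add DERIV_cdivide DERIV_ident)
    then show "((\<lambda>\<theta>. ?\<mu> \<theta> powr (1 - r) / b + \<theta>) has_real_derivative 0) (at \<theta> within ?\<Theta>)"
      using b by (auto intro: has_field_derivative_at_within)
  qed
  then obtain c where c: "\<And>\<theta>. \<theta> \<in> ?\<Theta> \<Longrightarrow> ?\<mu> \<theta> powr (1 - r) / b + \<theta> = c" by blast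
  have c': "?\<mu> \<theta> powr (1 - r) = b * (c - \<theta>)" if "\<theta> \<in> ?\<Theta>" for \<theta>
    using c[OF that] b by (auto simp: field_simps)
  \<comment> \<open>The factor that appears on solving
    \<open>u powr (1 - r) = b * (c - \<theta>)\<close> for u.\<close>
  define K where "K = b powr - (1 / (r - 1))"
  have inv: "u = K * (c - \<theta>) powr - (1 / (r - 1)) \<longleftrightarrow> u powr (1 - r) = b * (c - \<theta>)"
    if "u > 0" "\<theta> < c" for u \<theta>
  proof -
    have K': "K * (c - \<theta>) powr - (1 / (r - 1)) = (b * (c - \<theta>)) powr - (1 / (r - 1))"
      using b that by (simp add: K_def powr_mult)
    have e: "- (1 / (r - 1)) * (1 - r) = 1" "(1 - r) * - (1 / (r - 1)) = 1" using r by (auto simp: field_simps)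
    show ?thesis unfolding K'
    proof
      assume "u = (b * (c - \<theta>)) powr - (1 / (r - 1))"
      then show "u powr (1 - r) = b * (c - \<theta>)"
        using b that by (simp only: powr_powr e) simp
    next
      assume "u powr (1 - r) = b * (c - \<theta>)"
      then have "(b * (c - \<theta>)) powr - (1 / (r - 1)) = (u powr (1 - r)) powr - (1 / (r - 1))" by simp
      also have "\<dots> = u" using that by (simp only: powr_powr e) simp
      finally show "u = (b * (c - \<theta>)) powr - (1 / (r - 1))" by simp
    qed
  qed
  have less: "\<theta> < c" if "\<theta> \<in> ?\<Theta>" for \<theta>
  proof -
    have "?\<mu> \<theta> powr (1 - r) > 0" using pos[OF that] by simp
    then show ?thesis using c'[OF that] b by (simp add: zero_less_mult_iff)
  qed
  have K: "K > 0" using b by (simp add: K_def)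
  \<comment> \<open>The value u predicted at \<theta> is positive, hence is the mean at some s in
    the domain. The first integral at s then forces s = \<theta>.\<close>
  have mem: "\<theta> \<in> ?\<Theta>" if "\<theta> < c" for \<theta>
  proof -
    define u where "u = K * (c - \<theta>) powr - (1 / (r - 1))"
    have u: "u > 0" using K that by (simp add: u_def)
    then have "u \<in> mean_domain \<beta>" using dom by simp
    then obtain s where s: "s \<in> ?\<Theta>" "u = ?\<mu> s" by (auto simp: mean_domain_def)
    have "b * (c - s) = b * (c - \<theta>)"
      using c'[OF s(1)] inv[OF u that] u_def unfolding s(2) by metis
    then show ?thesis using b s by simp
  qed
  have mu: "?\<mu> \<theta> = K * (c - \<theta>) powr - (1 / (r - 1))" if "\<theta> < c" for \<theta>
    using inv[OF pos[OF mem[OF that]] that] c'[OF mem[OF that]] by simp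
  show thesis
  proof (rule that[OF K])
    show "?\<Theta> = {..<c}" using less mem by auto
    show "?\<mu> \<theta> = K * (c - \<theta>) powr - (1 / (r - 1))" if "\<theta> < c" for \<theta> by (rule mu[OF that])
    show "nef_variance \<theta> = a * K powr r * (c - \<theta>) powr - (r / (r - 1))" if "\<theta> < c" for \<theta>
    proof -
      have "nef_variance \<theta> = a * (K powr r * ((c - \<theta>) powr - (1 / (r - 1))) powr r)"
        using V[OF mem[OF that]] mu[OF that] K that by (simp add: powr_mult)
      then show ?thesis by (simp add: powr_powr)
    qed
  qed
qed

text \<open>A positive mean makes \<open>L\<close> increasing, so \<open>L\<close> is bounded at \<open>-\<infinity>\<close>, which leaves no room
  for mass on the negative half-line.\<close>

lemma AE_nonneg_basis:
  assumes dom: "nef_domain \<beta> = {..<c}"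
    and pos: "\<And>\<theta>. \<theta> < c \<Longrightarrow> mean_function \<beta> \<theta> > 0"
  shows "AE x in \<beta>. 0 \<le> x"
proof -
  have mono: "exp_moment 0 s \<le> exp_moment 0 t" if "s \<le> t" "t < c" for s t
  proof (rule DERIV_nonneg_imp_nondecreasing[OF \<open>s \<le> t\<close>])
    fix x assume "s \<le> x" "x \<le> t"
    then have x: "x \<in> nef_domain \<beta>" "x < c" using that dom by auto
    have "exp_moment 1 x = mean_function \<beta> x * exp_moment 0 x"
      using exp_moment_0_pos[OF x(1)] by (simp add: mean_function_eq x)
    then have "exp_moment (Suc 0) x \<ge> 0" using pos[OF x(2)] exp_moment_0_pos[OF x(1)] by simp
    then show "\<exists>y. (exp_moment 0 has_real_derivative y) (at x) \<and> 0 \<le> y"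
      using DERIV_exp_moment[OF x(1), of 0] by blast
  qed
  \<comment> \<open>By monotonicity, B bounds the Laplace transform at every t up to c - 1.\<close>
  define B where "B = exp_moment 0 (c - 1)"
  have null: "emeasure \<beta> {..- e} = 0" if e: "e > 0" for e :: real
  proof -
    \<comment> \<open>A Chernoff bound: t \<le> 0 gives the right sign in the exponent and t \<le> c
      - 1 gives the bound B. Letting t tend to minus infinity makes the right side vanish.\<close>
    have "emeasure \<beta> {..- e} \<le> ennreal (exp (e * t) * B)" if t: "t \<le> min 0 (c - 1)" for t
    proof -
      have "emeasure \<beta> {..- e} = (\<integral>\<^sup>+x. indicator {..- e} x \<partial>\<beta>)"
        by (simp add: sets_basis)
      also have "\<dots> \<le> (\<integral>\<^sup>+x. ennreal (exp (e * t)) * ennreal (exp (x * t)) \<partial>\<beta>)"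
      proof (rule nn_integral_mono)
        fix x :: real
        have "0 \<le> e * t + x * t" if "x \<le> - e"
          using that t mult_nonpos_nonpos[of "e + x" t] by (simp add: distrib_right)
        then show "indicator {..- e} x \<le> ennreal (exp (e * t)) * ennreal (exp (x * t))"
          by (auto simp: indicator_def ennreal_mult'[symmetric] exp_add[symmetric])
      qed
      also have "\<dots> = ennreal (exp (e * t)) * laplace \<beta> t"
        unfolding laplace_def by (rule nn_integral_cmult) measurable
      also have "\<dots> = ennreal (exp (e * t) * exp_moment 0 t)"
        using laplace_eq[of t] t dom by (simp add: ennreal_mult')
      also have "\<dots> \<le> ennreal (exp (e * t) * B)"
        using mono[of t "c - 1"] t by (auto intro!: ennreal_leI simp: B_def)
      finally show ?thesis .
    qed
    then have "\<forall>\<^sub>F t in at_bot. emeasure \<beta> {..- e} \<le> ennreal (exp (e * t) * B)"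
      unfolding eventually_at_bot_linorder by blast
    moreover have "((\<lambda>t. ennreal (exp (e * t) * B)) \<longlongrightarrow> ennreal (0 * B)) at_bot"
    proof (intro tendsto_ennrealI tendsto_mult tendsto_const)
      have "filterlim (\<lambda>t. e * t) at_bot at_bot"
        using e by (intro filterlim_tendsto_pos_mult_at_bot[OF tendsto_const] filterlim_ident)
      then show "((\<lambda>t. exp (e * t)) \<longlongrightarrow> 0) at_bot"
        by (rule filterlim_compose[OF exp_at_bot])
    qed
    ultimately have "emeasure \<beta> {..- e} \<le> ennreal (0 * B)"
      by (intro tendsto_lowerbound) auto
    then show ?thesis by simp
  qed
  \<comment> \<open>The open negative half-line is the union of the countably many null half-lines
    ending at - 1 / (n + 1).\<close>
  have "AE x in \<beta>. \<forall>n::nat. \<not> x \<le> - (1 / Suc n)"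
  proof (subst AE_all_countable, rule allI)
    fix n :: nat
    have "{..- (1 / Suc n)} \<in> null_sets \<beta>"
      using null[of "1 / Suc n"] by (intro null_setsI) (auto simp: sets_basis)
    then show "AE x in \<beta>. \<not> x \<le> - (1 / Suc n)"
      by (auto dest: AE_not_in)
  qed
  then show ?thesis
  proof eventually_elim
    case (elim x)
    show "0 \<le> x"
    proof (rule ccontr)
      assume "\<not> 0 \<le> x"
      then obtain n where "1 / Suc n < - x" using nat_approx_posE[of "- x"] by auto
      then show False using elim by (auto simp: not_le dest: spec[of _ n])
    qed
  qed
qed

end

section \<open>Gamma densities and convolutions\<close>

text \<open>For positive K and q, a gamma density of shape q and rate c, scaled so that its Laplace
  transform is \<open>K * (c - \<theta>) powr - q\<close> for \<theta> < c. The rate c may be zero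
  or negative, and then the total mass is infinite.\<close>

definition gamma_kernel :: "real \<Rightarrow> real \<Rightarrow> real \<Rightarrow> real \<Rightarrow> real" where
  "gamma_kernel K q c y = (if 0 < y then K / Gamma q * y powr (q - 1) * exp (- (c * y)) else 0)"

lemma gamma_kernel_measurable[measurable]: "gamma_kernel K q c \<in> borel_measurable borel"
  unfolding gamma_kernel_def[abs_def] by measurable

lemma gamma_kernel_nonneg: "K > 0 \<Longrightarrow> q > 0 \<Longrightarrow> gamma_kernel K q c y \<ge> 0"
  by (auto simp: gamma_kernel_def intro!: mult_nonneg_nonneg divide_nonneg_nonneg
      less_imp_le[OF Gamma_real_pos])

lemma gamma_kernel_eq_0_iff: "K > 0 \<Longrightarrow> q > 0 \<Longrightarrow> gamma_kernel K q c y = 0 \<longleftrightarrow> y \<le> 0"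
  using Gamma_real_pos[of q] by (auto simp: gamma_kernel_def less_le)

lemma laplace_gamma_kernel:
  assumes K: "K > 0" and q: "q > 0" and \<theta>: "\<theta> < c"
  shows "laplace (density lborel (\<lambda>y. ennreal (gamma_kernel K q c y))) \<theta>
          = ennreal (K * (c - \<theta>) powr - q)"
proof -
  define s where "s = c - \<theta>"
  have s: "s > 0" using \<theta> by (simp add: s_def)
  have G: "Gamma q > 0" using Gamma_real_pos q by simp
  have "laplace (density lborel (\<lambda>y. ennreal (gamma_kernel K q c y))) \<theta>
      = (\<integral>\<^sup>+y. ennreal (gamma_kernel K q c y) * ennreal (exp (y * \<theta>)) \<partial>lborel)"
    unfolding laplace_def by (rule nn_integral_density) measurable
  \<comment> \<open>The substitution y = x / s with s = c - \<theta> turns the integral into Euler's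
    integral for \<open>Gamma q\<close>.\<close>
  also have "\<dots> = ennreal \<bar>1 / s\<bar> * (\<integral>\<^sup>+x. ennreal (gamma_kernel K q c (0 + 1 / s * x))
      * ennreal (exp ((0 + 1 / s * x) * \<theta>)) \<partial>lborel)"
    using s by (intro nn_integral_real_affine) auto
  also have "(\<integral>\<^sup>+x. ennreal (gamma_kernel K q c (0 + 1 / s * x)) * ennreal (exp ((0 + 1 / s * x) * \<theta>)) \<partial>lborel)
    = (\<integral>\<^sup>+x. ennreal (K / Gamma q * (1 / s) powr (q - 1)) *
         ennreal (indicator {0..} x * x powr (q - 1) / exp x) \<partial>lborel)"
  proof (rule nn_integral_cong)
    fix x :: real
    show "ennreal (gamma_kernel K q c (0 + 1 / s * x)) * ennreal (exp ((0 + 1 / s * x) * \<theta>))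
      = ennreal (K / Gamma q * (1 / s) powr (q - 1)) *
         ennreal (indicator {0..} x * x powr (q - 1) / exp x)"
    proof (cases "x > 0")
      case True
      have "- (c * (1 / s * x)) + (1 / s * x) * \<theta> = - x"
        using s by (simp add: s_def divide_simps) (simp add: algebra_simps)
      then have e: "exp (- (c * (1 / s * x))) * exp ((1 / s * x) * \<theta>) = 1 / exp x"
        by (simp only: exp_add[symmetric]) (simp add: exp_minus inverse_eq_divide)
      have "gamma_kernel K q c (1 / s * x) * exp ((1 / s * x) * \<theta>)
          = K / Gamma q * (1 / s * x) powr (q - 1) * (exp (- (c * (1 / s * x))) * exp ((1 / s * x) * \<theta>))"
        using True s by (simp add: gamma_kernel_def)
      also have "\<dots> = K / Gamma q * (1 / s) powr (q - 1) * (indicator {0..} x * x powr (q - 1) / exp x)"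
        unfolding e using True s by (subst powr_mult) auto
      finally have "gamma_kernel K q c (1 / s * x) * exp ((1 / s * x) * \<theta>) = \<dots>" .
      then show ?thesis
        using gamma_kernel_nonneg[OF K q] K G
        by (simp only: ennreal_mult''[symmetric] ennreal_mult'[symmetric] exp_ge_zero add_0
            divide_nonneg_nonneg mult_nonneg_nonneg powr_ge_zero less_imp_le)
    next
      case False
      \<comment> \<open>At x = 0 the indicator is 1, but \<open>0 powr (q - 1)\<close> is 0 by
        convention, so both sides vanish.\<close>
      then show ?thesis using s by (cases "x = 0") (auto simp: gamma_kernel_def zero_less_divide_iff)
    qed
  qed
  also have "\<dots> = ennreal (K / Gamma q * (1 / s) powr (q - 1)) * ennreal (Gamma q)"
    unfolding Gamma_conv_nn_integral_real[OF q] by (rule nn_integral_cmult) measurable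
  also have "\<dots> = ennreal (K * (1 / s) powr (q - 1))"
    using K G by (simp add: ennreal_mult'[symmetric])
  also have "ennreal \<bar>1 / s\<bar> * \<dots> = ennreal (1 / s * (K * (1 / s) powr (q - 1)))"
    using s by (simp add: ennreal_mult'[symmetric])
  also have "1 / s * (K * (1 / s) powr (q - 1)) = K * ((1 / s) powr 1 * (1 / s) powr (q - 1))"
    using s by simp
  also have "\<dots> = K * s powr - q"
    unfolding powr_add[symmetric] using s by (simp add: powr_divide powr_minus_divide)
  finally show ?thesis by (simp add: s_def)
qed

section \<open>Convolutions of sigma-finite measures\<close>

lemma nn_integral_convolution_sigma_finite:
  fixes M N :: "real measure"
  assumes [measurable_cong]: "sets M = sets borel" "sets N = sets borel"
    and "sigma_finite_measure N" and [measurable]: "f \<in> borel_measurable borel"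
  shows "(\<integral>\<^sup>+x. f x \<partial>convolution M N) = (\<integral>\<^sup>+x. \<integral>\<^sup>+y. f (x + y) \<partial>N \<partial>M)"
proof -
  interpret sigma_finite_measure N by fact
  have "(\<integral>\<^sup>+x. f x \<partial>convolution M N) = (\<integral>\<^sup>+z. f (fst z + snd z) \<partial>(M \<Otimes>\<^sub>M N))"
    unfolding convolution_def by (subst nn_integral_distr) (auto simp: case_prod_beta)
  also have "\<dots> = (\<integral>\<^sup>+x. \<integral>\<^sup>+y. f (x + y) \<partial>N \<partial>M)"
    by (subst nn_integral_fst[symmetric]) auto
  finally show ?thesis .
qed

lemma laplace_convolution:
  fixes M N :: "real measure"
  assumes M[measurable_cong]: "sets M = sets borel" and N[measurable_cong]: "sets N = sets borel"
    and s: "sigma_finite_measure N"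
  shows "laplace (convolution M N) \<theta> = laplace M \<theta> * laplace N \<theta>"
proof -
  have "laplace (convolution M N) \<theta> = (\<integral>\<^sup>+x. \<integral>\<^sup>+y. ennreal (exp ((x + y) * \<theta>)) \<partial>N \<partial>M)"
    unfolding laplace_def by (rule nn_integral_convolution_sigma_finite[OF M N s]) measurable
  also have "\<dots> = (\<integral>\<^sup>+x. \<integral>\<^sup>+y. ennreal (exp (x * \<theta>)) * ennreal (exp (y * \<theta>)) \<partial>N \<partial>M)"
    by (simp add: ennreal_mult'[symmetric] exp_add[symmetric] distrib_right)
  also have "\<dots> = (\<integral>\<^sup>+x. ennreal (exp (x * \<theta>)) * laplace N \<theta> \<partial>M)"
    unfolding laplace_def by (intro nn_integral_cong nn_integral_cmult) measurable
  also have "\<dots> = laplace M \<theta> * laplace N \<theta>"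
    unfolding laplace_def by (rule nn_integral_multc) measurable
  finally show ?thesis .
qed

text \<open>Translation invariance of Lebesgue measure followed by Tonelli. The new density stays in
  \<open>ennreal\<close> because it may be infinite at some points.\<close>

lemma convolution_density_lborel:
  fixes M :: "real measure" and g :: "real \<Rightarrow> real"
  assumes M[measurable_cong]: "sets M = sets borel" and s: "sigma_finite_measure M"
    and g[measurable]: "g \<in> borel_measurable borel"
  shows "convolution M (density lborel (\<lambda>y. ennreal (g y)))
    = density lborel (\<lambda>z. \<integral>\<^sup>+x. ennreal (g (z - x)) \<partial>M)"
proof (rule measure_eqI)
  interpret M: sigma_finite_measure M by (rule s)
  interpret pair_sigma_finite M lborel ..
  have sN: "sigma_finite_measure (density lborel (\<lambda>y. ennreal (g y)))"
    by (subst sigma_finite_measure.sigma_finite_iff_density_finite[OF sigma_finite_lborel]) auto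
  fix A assume "A \<in> sets (convolution M (density lborel (\<lambda>y. ennreal (g y))))"
  then have [measurable]: "A \<in> sets borel" by simp
  have "emeasure (convolution M (density lborel (\<lambda>y. ennreal (g y)))) A
     = (\<integral>\<^sup>+z. indicator A z \<partial>convolution M (density lborel (\<lambda>y. ennreal (g y))))" by simp
  also have "\<dots> = (\<integral>\<^sup>+x. \<integral>\<^sup>+y. indicator A (x + y) \<partial>density lborel (\<lambda>y. ennreal (g y)) \<partial>M)"
    by (rule nn_integral_convolution_sigma_finite[OF M _ sN]) auto
  also have "\<dots> = (\<integral>\<^sup>+x. \<integral>\<^sup>+y. ennreal (g y) * indicator A (x + y) \<partial>lborel \<partial>M)"
    by (intro nn_integral_cong nn_integral_density) auto
  also have "\<dots> = (\<integral>\<^sup>+x. \<integral>\<^sup>+z. ennreal (g (z - x)) * indicator A z \<partial>lborel \<partial>M)"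
  proof (rule nn_integral_cong)
    fix x
    show "(\<integral>\<^sup>+y. ennreal (g y) * indicator A (x + y) \<partial>lborel)
      = (\<integral>\<^sup>+z. ennreal (g (z - x)) * indicator A z \<partial>lborel)"
      using nn_integral_real_affine[of "\<lambda>y. ennreal (g y) * indicator A (x + y)" 1 "- x"]
      by (simp add: algebra_simps)
  qed
  also have "\<dots> = (\<integral>\<^sup>+z. \<integral>\<^sup>+x. ennreal (g (z - x)) * indicator A z \<partial>M \<partial>lborel)"
    by (rule Fubini'[symmetric]) measurable
  also have "\<dots> = (\<integral>\<^sup>+z. (\<integral>\<^sup>+x. ennreal (g (z - x)) \<partial>M) * indicator A z \<partial>lborel)"
    by (intro nn_integral_cong nn_integral_multc) measurable
  also have "\<dots> = emeasure (density lborel (\<lambda>z. \<integral>\<^sup>+x. ennreal (g (z - x)) \<partial>M)) A"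
    by (subst emeasure_density) auto
  finally show "emeasure (convolution M (density lborel (\<lambda>y. ennreal (g y)))) A
    = emeasure (density lborel (\<lambda>z. \<integral>\<^sup>+x. ennreal (g (z - x)) \<partial>M)) A" .
qed simp

text \<open>The density of the first convolution vanishes at z exactly when
  \<open>f (z - x) \<le> 0\<close> for M-almost all x, and then the same holds for g. The condition
  \<open>zero\<close> uses \<le> because \<open>ennreal\<close> sends negative values to 0.\<close>

lemma absolutely_continuous_convolution_density:
  fixes M :: "real measure" and f g :: "real \<Rightarrow> real"
  assumes M[measurable_cong]: "sets M = sets borel" and s: "sigma_finite_measure M"
    and f[measurable]: "f \<in> borel_measurable borel" and g[measurable]: "g \<in> borel_measurable borel"
    and zero: "\<And>y. f y \<le> 0 \<Longrightarrow> g y \<le> 0"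
  shows "absolutely_continuous (convolution M (density lborel (\<lambda>y. ennreal (f y))))
           (convolution M (density lborel (\<lambda>y. ennreal (g y))))"
proof -
  interpret M: sigma_finite_measure M by (rule s)
  have imp: "(\<integral>\<^sup>+x. ennreal (g (z - x)) \<partial>M) = 0" if "(\<integral>\<^sup>+x. ennreal (f (z - x)) \<partial>M) = 0" for z
  proof -
    have "AE x in M. ennreal (f (z - x)) = 0"
      using that by (subst (asm) nn_integral_0_iff_AE) auto
    then have "AE x in M. ennreal (g (z - x)) = 0"
      by eventually_elim (auto simp: ennreal_eq_0_iff zero)
    then show ?thesis by (subst nn_integral_0_iff_AE) auto
  qed
  show ?thesis
    unfolding convolution_density_lborel[OF M s f] convolution_density_lborel[OF M s g]
      absolutely_continuous_def
  proof
    fix A assume "A \<in> null_sets (density lborel (\<lambda>z. \<integral>\<^sup>+x. ennreal (f (z - x)) \<partial>M))"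
    then have A: "A \<in> sets lborel" "AE z in lborel. z \<in> A \<longrightarrow> (\<integral>\<^sup>+x. ennreal (f (z - x)) \<partial>M) = 0"
      by (auto simp: null_sets_density_iff)
    from A(2) have "AE z in lborel. z \<in> A \<longrightarrow> (\<integral>\<^sup>+x. ennreal (g (z - x)) \<partial>M) = 0"
      by eventually_elim (auto simp: imp)
    with A(1) show "A \<in> null_sets (density lborel (\<lambda>z. \<integral>\<^sup>+x. ennreal (g (z - x)) \<partial>M))"
      by (subst null_sets_density_iff) auto
  qed
qed

section \<open>Induced measure and reduction function\<close>

text \<open>Uniqueness of Laplace transforms on the open domain discharges the definite
  description.\<close>

lemma (in nef) induced_measure_eqI:
  assumes "sets \<rho> = sets borel"
    and "\<And>\<theta>. \<theta> \<in> nef_domain \<beta> \<Longrightarrow> laplace \<rho> \<theta> = ennreal (nef_variance \<theta>)"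
  shows "induced_measure \<beta> = \<rho>"
  unfolding induced_measure_def
proof (rule the_equality)
  show "sets \<rho> = sets borel \<and> (\<forall>\<theta>\<in>nef_domain \<beta>. laplace \<rho> \<theta> = ennreal (deriv (deriv (cumulant \<beta>)) \<theta>))"
    using assms by (simp add: deriv2_cumulant)
  fix \<rho>' assume "sets \<rho>' = sets borel \<and>
    (\<forall>\<theta>\<in>nef_domain \<beta>. laplace \<rho>' \<theta> = ennreal (deriv (deriv (cumulant \<beta>)) \<theta>))"
  then show "\<rho>' = \<rho>"
    using assms open_domain domain_nonempty
    by (intro laplace_unique[of \<rho>' \<rho> "nef_domain \<beta>"]) (auto simp: deriv2_cumulant)
qed

text \<open>The Bochner integral needs finiteness of the density almost everywhere, which follows from
  that of the Laplace transform.\<close>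

lemma (in nef) reduction_function_RN_deriv:
  assumes ac: "absolutely_continuous \<beta> \<alpha>" and sets: "sets \<alpha> = sets borel"
    and lap: "\<And>\<theta>. \<theta> \<in> nef_domain \<beta> \<Longrightarrow> laplace \<alpha> \<theta> = laplace \<beta> \<theta> * ennreal (nef_variance \<theta>)"
  shows "reduction_function \<beta> (\<lambda>x. enn2real (RN_deriv \<beta> \<alpha> x))"
  unfolding reduction_function_def
proof
  fix \<theta> assume \<theta>: "\<theta> \<in> nef_domain \<beta>"
  let ?f = "RN_deriv \<beta> \<alpha>"
  let ?m = "exp_moment 0 \<theta>"
  have m: "?m > 0" by (rule exp_moment_0_pos[OF \<theta>])
  have dens: "density \<beta> ?f = \<alpha>" using ac sets by (intro density_RN_deriv) (auto simp: sets_basis)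
  have "laplace (density \<beta> ?f) \<theta> = (\<integral>\<^sup>+x. ?f x * ennreal (exp (x * \<theta>)) \<partial>\<beta>)"
    unfolding laplace_def by (rule nn_integral_density) measurable
  with lap[OF \<theta>] have L: "(\<integral>\<^sup>+x. ?f x * ennreal (exp (x * \<theta>)) \<partial>\<beta>) = ennreal (?m * nef_variance \<theta>)"
    using m by (simp add: dens laplace_eq \<theta> ennreal_mult')
  have "AE x in \<beta>. ?f x * ennreal (exp (x * \<theta>)) \<noteq> \<infinity>"
    by (rule nn_integral_PInf_AE) (auto simp: L)
  then have fin: "AE x in \<beta>. ?f x = ennreal (enn2real (?f x))"
    by eventually_elim (auto simp: ennreal_mult_eq_top_iff less_top[symmetric])
  have "(\<integral>\<^sup>+x. ennreal (enn2real (?f x)) \<partial>nef_member \<beta> \<theta>)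
      = (\<integral>\<^sup>+x. ennreal (exp (\<theta> * x) / ?m) * ennreal (enn2real (?f x)) \<partial>\<beta>)"
    unfolding nef_member_eq[OF \<theta>] by (rule nn_integral_density) measurable
  also have "\<dots> = (\<integral>\<^sup>+x. ennreal (1 / ?m) * (?f x * ennreal (exp (x * \<theta>))) \<partial>\<beta>)"
  proof (rule nn_integral_cong_AE)
    show "AE x in \<beta>. ennreal (exp (\<theta> * x) / ?m) * ennreal (enn2real (?f x))
        = ennreal (1 / ?m) * (?f x * ennreal (exp (x * \<theta>)))"
      using fin
    proof eventually_elim
      case (elim x)
      have "ennreal (exp (\<theta> * x) / ?m) = ennreal (1 / ?m) * ennreal (exp (x * \<theta>))"
        using m by (simp add: ennreal_mult'[symmetric] mult.commute)
      then show ?case using elim by (simp add: mult_ac)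
    qed
  qed
  also have "\<dots> = ennreal (1 / ?m) * ennreal (?m * nef_variance \<theta>)"
    unfolding L[symmetric] by (rule nn_integral_cmult) measurable
  \<comment> \<open>The factor L(\<theta>) of the transform of \<alpha> cancels the normalisation of
    the family member.\<close>
  also have "\<dots> = ennreal (nef_variance \<theta>)"
    using m by (simp add: ennreal_mult'[symmetric])
  finally have N: "(\<integral>\<^sup>+x. ennreal (enn2real (?f x)) \<partial>nef_member \<beta> \<theta>) = ennreal (nef_variance \<theta>)" .
  have meas: "(\<lambda>x. enn2real (?f x)) \<in> borel_measurable (nef_member \<beta> \<theta>)"
    unfolding nef_member_def by measurable
  have "integrable (nef_member \<beta> \<theta>) (\<lambda>x. enn2real (?f x))"
    using meas by (intro integrableI_nonneg) (auto simp: N)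
  moreover have "(\<integral>x. enn2real (?f x) \<partial>nef_member \<beta> \<theta>) = nef_variance \<theta>"
    using meas nef_variance_pos[OF \<theta>] by (subst integral_eq_nn_integral) (auto simp: N)
  ultimately show "integrable (nef_member \<beta> \<theta>) (\<lambda>x. enn2real (?f x)) \<and>
     prob_space.expectation (nef_member \<beta> \<theta>) (\<lambda>x. enn2real (?f x)) =
     prob_space.variance (nef_member \<beta> \<theta>) (\<lambda>x. x)"
    by (simp add: nef_variance_def mean_function_def)
qed

theorem corollary2:
  fixes \<beta> \<rho> \<alpha> :: "real measure" and a r :: real
  assumes "nef_basis \<beta>"
    and "a > 0"
    and "r \<in> ({0} \<union> {1..}) - \<nat>"
    and "mean_domain \<beta> = {0<..}"
    and "\<forall>u\<in>mean_domain \<beta>. variance_function \<beta> u = a * u powr r"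
    and "\<rho> = induced_measure \<beta>"
    and "\<alpha> = convolution \<beta> \<rho>"
  shows "absolutely_continuous \<beta> \<alpha> \<and>
         reduction_function \<beta> (\<lambda>x. enn2real (RN_deriv \<beta> \<alpha> x))"
proof -
  interpret nef \<beta> by standard (rule assms(1))
  \<comment> \<open>Both 0 and 1 are natural numbers, so their exclusion leaves r > 1.\<close>
  have "r \<noteq> 0" "r \<noteq> 1" using assms(3) Nats_0 Nats_1 by (metis DiffD2)+
  then have r: "r > 1" using assms(3) by auto
  define p where "p = 1 / (r - 1)"
  have p: "p > 0" "r / (r - 1) = p + 1" using r by (auto simp: p_def field_simps)
  obtain K c where K: "K > 0" and dom: "nef_domain \<beta> = {..<c}"
    and mean: "\<And>\<theta>. \<theta> < c \<Longrightarrow> mean_function \<beta> \<theta> = K * (c - \<theta>) powr - p"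
    and var: "\<And>\<theta>. \<theta> < c \<Longrightarrow> nef_variance \<theta> = a * K powr r * (c - \<theta>) powr - (p + 1)"
    using power_variance_solution[OF assms(2) r assms(4,5)] unfolding p(2) p_def[symmetric] by metis
  \<comment> \<open>The shapes p + 1 and p are the exponents of the variance and of the mean, so g
    and h have these two functions as Laplace transforms.\<close>
  define g where "g = gamma_kernel (a * K powr r) (p + 1) c"
  define h where "h = gamma_kernel K p c"
  have [measurable]: "g \<in> borel_measurable borel" "h \<in> borel_measurable borel"
    by (simp_all add: g_def h_def)
  have aK: "a * K powr r > 0" "p + 1 > 0" using assms(2) K p by auto
  have \<rho>: "\<rho> = density lborel (\<lambda>y. ennreal (g y))"
    unfolding assms(6) g_def using aK
    by (intro induced_measure_eqI) (auto simp: laplace_gamma_kernel dom var)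
  define m where "m = density lborel (\<lambda>y. ennreal (h y))"
  have sf: "sigma_finite_measure \<rho>" "sigma_finite_measure m"
    unfolding \<rho> m_def by (subst sigma_finite_measure.sigma_finite_iff_density_finite[OF sigma_finite_lborel], auto)+
  have lm: "laplace m \<theta> = ennreal (mean_function \<beta> \<theta>)" if "\<theta> < c" for \<theta>
    using that K p by (simp add: m_def h_def laplace_gamma_kernel mean)
  \<comment> \<open>Since \<open>ennreal\<close> maps negative x to 0, this is what makes
    \<open>density \<beta> (\<lambda>x. ennreal x)\<close> the measure x \<beta>(dx), with transform
    \<open>exp_moment 1\<close>.\<close>
  have nonneg: "AE x in \<beta>. 0 \<le> x"
    using K by (intro AE_nonneg_basis[OF dom]) (simp add: mean)
  \<comment> \<open>\<open>L' = L \<kappa>'\<close>, read as an identity between measures.\<close>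
  have xb: "density \<beta> (\<lambda>x. ennreal x) = convolution \<beta> m"
  proof (rule laplace_unique[OF _ _ open_domain domain_nonempty])
    fix \<theta> assume \<theta>: "\<theta> \<in> nef_domain \<beta>"
    have "laplace (density \<beta> (\<lambda>x. ennreal x)) \<theta> = (\<integral>\<^sup>+x. ennreal x * ennreal (exp (x * \<theta>)) \<partial>\<beta>)"
      unfolding laplace_def by (rule nn_integral_density) measurable
    also have "\<dots> = (\<integral>\<^sup>+x. ennreal (x ^ 1 * exp (\<theta> * x)) \<partial>\<beta>)"
      by (intro nn_integral_cong) (simp add: ennreal_mult''[symmetric] mult.commute)
    also have "\<dots> = ennreal (exp_moment 1 \<theta>)"
      unfolding exp_moment_def using nonneg
      by (intro nn_integral_eq_integral integrable_exp_moment \<theta>) (auto elim!: eventually_mono)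
    also have "exp_moment 1 \<theta> = exp_moment 0 \<theta> * mean_function \<beta> \<theta>"
      using exp_moment_0_pos[OF \<theta>] by (simp add: mean_function_eq \<theta>)
    finally have l: "laplace (density \<beta> (\<lambda>x. ennreal x)) \<theta> = ennreal (exp_moment 0 \<theta> * mean_function \<beta> \<theta>)" .
    then show "laplace (density \<beta> (\<lambda>x. ennreal x)) \<theta> < \<infinity>" by simp
    have "laplace (convolution \<beta> m) \<theta> = laplace \<beta> \<theta> * laplace m \<theta>"
      by (rule laplace_convolution[OF sets_basis _ sf(2)]) (simp add: m_def)
    also have "\<dots> = ennreal (exp_moment 0 \<theta> * mean_function \<beta> \<theta>)"
      using \<theta> dom exp_moment_0_pos[OF \<theta>] by (simp add: lm laplace_eq ennreal_mult')
    finally show "laplace (density \<beta> (\<lambda>x. ennreal x)) \<theta> = laplace (convolution \<beta> m) \<theta>"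
      using l by simp
  qed (auto simp: sets_basis)
  \<comment> \<open>Both kernels vanish exactly on the non-positive half-line.\<close>
  have "absolutely_continuous (convolution \<beta> m) \<alpha>"
    unfolding assms(7) \<rho> m_def
  proof (rule absolutely_continuous_convolution_density[OF sets_basis sigma_finite_measure_axioms])
    fix y assume "h y \<le> 0"
    then show "g y \<le> 0"
      using gamma_kernel_nonneg[OF K p(1), of c y] gamma_kernel_eq_0_iff[OF K p(1), of c y]
        gamma_kernel_eq_0_iff[OF aK, of c y] by (simp add: g_def h_def)
  qed measurable
  \<comment> \<open>By \<open>xb\<close> this convolution has a density with respect to \<beta>,
    although it was built from a Lebesgue density.\<close>
  moreover have "absolutely_continuous \<beta> (convolution \<beta> m)"
    unfolding xb[symmetric] by (rule absolutely_continuousI_density) measurable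
  ultimately have ac: "absolutely_continuous \<beta> \<alpha>"
    unfolding absolutely_continuous_def by (rule order_trans[rotated])
  moreover have "reduction_function \<beta> (\<lambda>x. enn2real (RN_deriv \<beta> \<alpha> x))"
  proof (rule reduction_function_RN_deriv[OF ac])
    show "sets \<alpha> = sets borel" by (simp add: assms(7))
    fix \<theta> assume \<theta>: "\<theta> \<in> nef_domain \<beta>"
    have "laplace \<alpha> \<theta> = laplace \<beta> \<theta> * laplace \<rho> \<theta>"
      unfolding assms(7) by (rule laplace_convolution[OF sets_basis _ sf(1)]) (simp add: \<rho>)
    also have "laplace \<rho> \<theta> = ennreal (nef_variance \<theta>)"
      using \<theta> dom aK by (simp add: \<rho> g_def laplace_gamma_kernel var)
    finally show "laplace \<alpha> \<theta> = laplace \<beta> \<theta> * ennreal (nef_variance \<theta>)" .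
  qed
  ultimately show ?thesis by simp
qed

end
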